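(* Let $\alpha,\epsilon,\delta>0$ and suppose $e^{\epsilon}/2+\delta+\alpha<1$. In the no-information two-database setting, any $(\epsilon,\delta)$-aDP property tester with proximity parameter $\alpha$ has per-database query complexity \[r=\Omega\left(\max\left\{n^{1-o(1)},\frac{1}{\alpha^2}\right\}\right).\]
   Context: An algorithm in the two-database setting is a pair $\mathcal{A}=(P_0,P_1)$ of probability distributions on $[n]=\{1,\dots,n\}$: it accepts two (neighbouring) databases $0,1$, and querying database $i$ returns an independent sample from $P_i$. Put $\delta^{\mathcal{A}}_\epsilon=\max_E\max\{P_0(E)-e^\epsilon P_1(E),\,P_1(E)-e^\epsilon P_0(E)\}$, maximum over events $E$. $\mathcal{A}$ is $(\epsilon,\delta)$-aDP (approximate differentially private) iff $\delta\ge\delta^{\mathcal{A}}_\epsilon$, and it is $\alpha$-far from $(\epsilon,\delta)$-aDP iff $\delta^{\mathcal{A}}_\epsilon-\delta>\alpha$. A (no-information) $(\epsilon,\delta)$-aDP property tester with proximity parameter $\alpha$ and per-database query complexity $r$ receives $r$ independent samples from each of the unknown $P_0,P_1$ (and no other information except $n$), and ACCEPTS with probability at least $2/3$ if $\mathcal{A}$ is $(\epsilon,\delta)$-aDP and REJECTS with probability at least $2/3$ if $\mathcal{A}$ is $\alpha$-far from $(\epsilon,\delta)$-aDP. The $o(1)$ is as $n\to\infty$ with $\epsilon,\delta,\alpha$ fixed; the constant in $\Omega$ may depend on $\epsilon,\delta$. *)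

theory Defs
  imports "HOL-Probability.Probability" "HOL-Library.Landau_Symbols"
begin

text \<open>
  An algorithm in the two-database setting is a pair of distributions on \<open>[n] = {1..n}\<close>, given as
  two natural-number PMFs whose supports lie in \<open>{1..n}\<close>.
\<close>

definition two_db_algorithm :: "nat \<Rightarrow> nat pmf \<times> nat pmf \<Rightarrow> bool" where
  "two_db_algorithm n A \<longleftrightarrow> set_pmf (fst A) \<subseteq> {1..n} \<and> set_pmf (snd A) \<subseteq> {1..n}"

definition adp_delta :: "nat \<Rightarrow> real \<Rightarrow> nat pmf \<times> nat pmf \<Rightarrow> real" where
  "adp_delta n \<epsilon> A =
    (MAX E\<in>Pow {1..n}.
       max (measure_pmf.prob (fst A) E - exp \<epsilon> * measure_pmf.prob (snd A) E)
           (measure_pmf.prob (snd A) E - exp \<epsilon> * measure_pmf.prob (fst A) E))"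

definition is_adp :: "nat \<Rightarrow> real \<Rightarrow> real \<Rightarrow> nat pmf \<times> nat pmf \<Rightarrow> bool" where
  "is_adp n \<epsilon> \<delta> A \<longleftrightarrow> \<delta> \<ge> adp_delta n \<epsilon> A"

definition far_from_adp :: "nat \<Rightarrow> real \<Rightarrow> real \<Rightarrow> real \<Rightarrow> nat pmf \<times> nat pmf \<Rightarrow> bool" where
  "far_from_adp n \<epsilon> \<delta> \<alpha> A \<longleftrightarrow> adp_delta n \<epsilon> A - \<delta> > \<alpha>"

text \<open>
  A tester maps the two sample lists to a distribution on verdicts (\<open>True\<close> means ACCEPT), so it may
  be randomised. It may also depend on \<open>n\<close>, \<open>\<epsilon>\<close>, \<open>\<delta>\<close>, \<open>\<alpha>\<close>, \<open>r\<close>, because all of these are fixed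
  before the tester is quantified over.
\<close>

definition run_tester ::
  "nat \<Rightarrow> (nat list \<Rightarrow> nat list \<Rightarrow> bool pmf) \<Rightarrow> nat pmf \<times> nat pmf \<Rightarrow> bool pmf" where
  "run_tester r T A =
    do {xs \<leftarrow> replicate_pmf r (fst A); ys \<leftarrow> replicate_pmf r (snd A); T xs ys}"

definition adp_tester ::
  "nat \<Rightarrow> real \<Rightarrow> real \<Rightarrow> real \<Rightarrow> nat \<Rightarrow> (nat list \<Rightarrow> nat list \<Rightarrow> bool pmf) \<Rightarrow> bool" where
  "adp_tester n \<epsilon> \<delta> \<alpha> r T \<longleftrightarrow>
    (\<forall>A. two_db_algorithm n A \<longrightarrow>
       (is_adp n \<epsilon> \<delta> A \<longrightarrow> pmf (run_tester r T A) True \<ge> 2/3) \<and>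
       (far_from_adp n \<epsilon> \<delta> \<alpha> A \<longrightarrow> pmf (run_tester r T A) False \<ge> 2/3))"

end

theory Submission
  imports Defs
begin

text \<open>
  The bound \<open>1 / \<alpha>\<^sup>2\<close> comes from two-point distributions: with \<open>P\<^sub>1\<close> uniform on two points, moving
  \<open>P\<^sub>0\<close> by \<open>O(\<alpha>)\<close> turns a private algorithm into an \<open>\<alpha>\<close>-far one, while the chi-square divergence
  between the two versions of \<open>P\<^sub>0\<close> is only \<open>O(\<alpha>\<^sup>2)\<close>.

  For the near-linear bound, take \<open>P\<^sub>1\<close> uniform and let \<open>P\<^sub>0\<close> be nearly uniform (private) or nearly
  uniform on half of the domain (far, as \<open>e\<^sup>\<epsilon> / 2 + \<delta> + \<alpha> < 1\<close>). A small amount of mass on a few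
  heavy elements makes the first \<open>K\<close> power sums of the two frequency patterns, which live on a block
  of constant length \<open>L\<close>, agree exactly. The domain consists of \<open>m = n div L\<close> blocks, and in each of
  them the pattern is permuted independently at random. The law of at most \<open>K\<close> samples from a
  randomly permuted block depends only on the first \<open>K\<close> power sums, so the two families can be told
  apart only if some block is hit more than \<open>K\<close> times. This has probability at most
  \<open>r ^ (K + 1) / m ^ K\<close>, whence \<open>r\<close> is at least of order \<open>n powr (K / (K + 1))\<close>.
\<close>

section \<open>Weighted words and chi-square divergence\<close>

definition words :: "'a set \<Rightarrow> nat \<Rightarrow> 'a list set" where
  "words U r = {xs. set xs \<subseteq> U \<and> length xs = r}"

text \<open>The expectation of \<open>g\<close> over \<open>r\<close> independent draws when
  \<open>w\<close> is a probability weight. Being a finite sum, it can be interchanged freely with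
  sums over permutations and over blocks.\<close>

definition mean :: "'a set \<Rightarrow> ('a \<Rightarrow> real) \<Rightarrow> nat \<Rightarrow> ('a list \<Rightarrow> real) \<Rightarrow> real" where
  "mean U w r g = (\<Sum>xs\<in>words U r. prod_list (map w xs) * g xs)"

lemma finite_words: "finite U \<Longrightarrow> finite (words U r)"
  unfolding words_def by (rule finite_lists_length_eq)

lemma words_0 [simp]: "words U 0 = {[]}"
  by (auto simp: words_def)

lemma mean_0 [simp]: "mean U w 0 g = g []"
  by (simp add: mean_def)

lemma mean_Suc: "mean U w (Suc r) g = (\<Sum>x\<in>U. w x * mean U w r (\<lambda>xs. g (x # xs)))"
proof -
  have eq: "words U (Suc r) = (\<lambda>(x, xs). x # xs) ` (U \<times> words U r)"
    by (force simp: words_def lists_length_Suc_eq)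
  have inj: "inj_on (\<lambda>(x, xs). x # xs) (U \<times> words U r)"
    by (auto simp: inj_on_def)
  have "mean U w (Suc r) g = (\<Sum>(x, xs)\<in>U \<times> words U r. w x * prod_list (map w xs) * g (x # xs))"
    unfolding mean_def eq by (subst sum.reindex[OF inj]) (simp add: case_prod_unfold)
  also have "\<dots> = (\<Sum>x\<in>U. \<Sum>xs\<in>words U r. w x * prod_list (map w xs) * g (x # xs))"
    by (rule sum.cartesian_product[symmetric])
  also have "\<dots> = (\<Sum>x\<in>U. w x * mean U w r (\<lambda>xs. g (x # xs)))"
    by (simp add: mean_def sum_distrib_left mult_ac)
  finally show ?thesis .
qed

lemma prod_list_map_nonneg:
  fixes w :: "'a \<Rightarrow> real"
  assumes "\<And>x. x \<in> set xs \<Longrightarrow> 0 \<le> w x"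
  shows "0 \<le> prod_list (map w xs)"
  using assms by (induction xs) auto

lemma mean_mono:
  assumes "\<And>x. x \<in> U \<Longrightarrow> 0 \<le> w x" and "\<And>xs. xs \<in> words U r \<Longrightarrow> g xs \<le> h xs"
  shows "mean U w r g \<le> mean U w r h"
  unfolding mean_def using assms
  by (intro sum_mono mult_left_mono prod_list_map_nonneg) (auto simp: words_def)

lemma mean_cong: "(\<And>x. x \<in> U \<Longrightarrow> w x = w' x) \<Longrightarrow> mean U w r g = mean U w' r g"
  unfolding mean_def words_def
  by (intro sum.cong refl arg_cong2[where f = "(*)"] arg_cong[where f = prod_list]) auto

lemma mean_add_mult: "mean U w r (\<lambda>xs. g xs + c * h xs) = mean U w r g + c * mean U w r h"
  by (simp add: mean_def algebra_simps sum.distrib sum_distrib_left)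

text \<open>Passes from PMFs to finite sums. \<open>U\<close> may exceed the support, so
  distributions with different supports can share one index set.\<close>

lemma expectation_replicate_pmf:
  fixes g :: "'a list \<Rightarrow> real"
  assumes U: "finite U" "set_pmf P \<subseteq> U"
  shows "measure_pmf.expectation (replicate_pmf r P) g = mean U (pmf P) r g"
proof (induction r arbitrary: g)
  case (Suc r)
  have fin: "finite (set_pmf (replicate_pmf r P))" for r
    by (rule finite_subset[OF _ finite_words[OF U(1), of r]])
       (use U(2) in \<open>auto simp: set_replicate_pmf words_def\<close>)
  have fU: "finite (set_pmf P)" using U finite_subset by blast
  have "measure_pmf.expectation (replicate_pmf (Suc r) P) g =
      (\<Sum>x\<in>U. pmf P x * measure_pmf.expectation (map_pmf (Cons x) (replicate_pmf r P)) g)"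
    using fin U fU
    by (simp add: map_pmf_def[symmetric] pmf_expectation_bind[of U])
  also have "\<dots> = mean U (pmf P) (Suc r) g"
    by (simp add: mean_Suc Suc)
  finally show ?case .
qed simp

text \<open>Change of measure from \<open>q\<close> to \<open>p\<close> by Cauchy-Schwarz, one
  coordinate at a time. For probability weights the sum of \<open>q\<^sup>2 / p\<close> is one plus
  the chi-square divergence, and it is multiplicative over independent draws.\<close>

lemma mean_square_le:
  assumes "finite U" and P: "\<And>x. x \<in> U \<Longrightarrow> 0 < p x" and Q: "\<And>x. x \<in> U \<Longrightarrow> 0 \<le> q x"
  shows "(mean U q r g)\<^sup>2 \<le> (\<Sum>x\<in>U. (q x)\<^sup>2 / p x) ^ r * mean U p r (\<lambda>xs. (g xs)\<^sup>2)"
proof (induction r arbitrary: g)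
  case (Suc r)
  let ?C = "\<Sum>x\<in>U. (q x)\<^sup>2 / p x"
  have C: "0 \<le> ?C"
    by (intro sum_nonneg divide_nonneg_pos P) auto
  define u where "u x = mean U q r (\<lambda>xs. g (x # xs))" for x
  have "(mean U q (Suc r) g)\<^sup>2 = (\<Sum>x\<in>U. (q x / sqrt (p x)) * (sqrt (p x) * u x))\<^sup>2"
    unfolding mean_Suc u_def
    by (intro arg_cong[where f = "\<lambda>z. z\<^sup>2"] sum.cong refl) (use P in force)
  also have "\<dots> \<le> (\<Sum>x\<in>U. (q x / sqrt (p x))\<^sup>2) * (\<Sum>x\<in>U. (sqrt (p x) * u x)\<^sup>2)"
    by (rule Cauchy_Schwarz_ineq_sum)
  also have "\<dots> = ?C * (\<Sum>x\<in>U. p x * (u x)\<^sup>2)"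
    by (intro arg_cong2[where f = "(*)"] sum.cong refl)
       (use P in \<open>auto simp: power_divide power_mult_distrib less_imp_le\<close>)
  also have "\<dots> \<le> ?C * (\<Sum>x\<in>U. p x * (?C ^ r * mean U p r (\<lambda>xs. (g (x # xs))\<^sup>2)))"
    unfolding u_def by (intro mult_left_mono sum_mono Suc C less_imp_le[OF P])
  also have "\<dots> = ?C ^ Suc r * mean U p (Suc r) (\<lambda>xs. (g xs)\<^sup>2)"
    by (simp add: mean_Suc sum_distrib_left mult_ac)
  finally show ?case .
qed simp

section \<open>Two-point algorithms\<close>

text \<open>Integrates out the samples of the second database. Each lower bound keeps
  \<open>P1\<close> the same for private and far algorithms, so the tester becomes one
  \<open>[0,1]\<close>-valued function of the samples from the first.\<close>

definition verdict_prob :: "nat \<Rightarrow> (nat list \<Rightarrow> nat list \<Rightarrow> bool pmf) \<Rightarrow> nat pmf \<Rightarrow> bool \<Rightarrow> nat list \<Rightarrow> real" where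
  "verdict_prob r T P1 v xs = pmf (bind_pmf (replicate_pmf r P1) (T xs)) v"

lemma pmf_run_tester:
  assumes "finite U" "set_pmf (fst A) \<subseteq> U"
  shows "pmf (run_tester r T A) v = mean U (pmf (fst A)) r (verdict_prob r T (snd A) v)"
  unfolding run_tester_def verdict_prob_def pmf_bind[of "replicate_pmf r (fst A)"]
  by (rule expectation_replicate_pmf[OF assms])

lemma verdict_prob_bounds: "0 \<le> verdict_prob r T P v xs" "verdict_prob r T P v xs \<le> 1"
  by (simp_all add: verdict_prob_def pmf_le_1)

lemma pmf_bool_False: "pmf (p :: bool pmf) False = 1 - pmf p True"
  using sum_pmf_eq_1[of UNIV p] by (simp add: UNIV_bool subset_iff)

lemma adp_delta_le_iff:
  "adp_delta n \<epsilon> A \<le> d \<longleftrightarrow> (\<forall>E\<subseteq>{1..n}.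
     measure_pmf.prob (fst A) E - exp \<epsilon> * measure_pmf.prob (snd A) E \<le> d \<and>
     measure_pmf.prob (snd A) E - exp \<epsilon> * measure_pmf.prob (fst A) E \<le> d)"
  unfolding adp_delta_def by (subst Max_le_iff) auto

lemma adp_delta_ge:
  assumes "E \<subseteq> {1..n}"
  shows "measure_pmf.prob (fst A) E - exp \<epsilon> * measure_pmf.prob (snd A) E \<le> adp_delta n \<epsilon> A"
    and "measure_pmf.prob (snd A) E - exp \<epsilon> * measure_pmf.prob (fst A) E \<le> adp_delta n \<epsilon> A"
  using adp_delta_le_iff[of n \<epsilon> A "adp_delta n \<epsilon> A"] assms by auto

definition two_point :: "real \<Rightarrow> nat pmf" where
  "two_point a = map_pmf (\<lambda>b. if b then 1 else 2) (bernoulli_pmf a)"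

lemma prob_two_point:
  assumes "0 \<le> a" "a \<le> 1"
  shows "measure_pmf.prob (two_point a) E = a * of_bool (1 \<in> E) + (1 - a) * of_bool (2 \<in> E)"
proof -
  let ?B = "(\<lambda>b. if b then 1 else 2) -` E"
  have "measure_pmf.prob (two_point a) E = measure_pmf.expectation (bernoulli_pmf a) (indicator ?B)"
    by (simp add: two_point_def)
  also have "\<dots> = a * of_bool (1 \<in> E) + (1 - a) * of_bool (2 \<in> E)"
    using assms by (subst integral_bernoulli_pmf) (auto simp: indicator_def)
  finally show ?thesis .
qed

lemma pmf_two_point:
  assumes "0 \<le> a" "a \<le> 1"
  shows "pmf (two_point a) (Suc 0) = a" "pmf (two_point a) 2 = 1 - a"
  using prob_two_point[OF assms, of "{1}"] prob_two_point[OF assms, of "{2}"]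
  by (simp_all add: measure_pmf_single)

lemma set_two_point: "set_pmf (two_point a) \<subseteq> {1, 2}"
  by (auto simp: two_point_def)

text \<open>The choice of \<open>a\<close> gives \<open>exp \<epsilon> * a = 1/2 - \<delta>\<close>,
  so the event \<open>{1}\<close> attains the privacy constraint with equality. Lowering
  \<open>a\<close> by order \<alpha> yields a far algorithm at chi-square divergence of order
  \<open>\<alpha>\<^sup>2\<close>.\<close>

lemma tester_ge_inverse_square:
  fixes \<epsilon> \<delta> \<alpha> :: real
  defines "a \<equiv> (1/2 - \<delta>) / exp \<epsilon>"
  assumes "\<epsilon> > 0" "\<delta> > 0" "\<alpha> > 0" and lt: "exp \<epsilon> / 2 + \<delta> + \<alpha> < 1" and n: "n \<ge> 2"
    and T: "adp_tester n \<epsilon> \<delta> \<alpha> r T"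
  shows "real r \<ge> a * (1 - a) * ln (4/3) / 4 * (1 / \<alpha>\<^sup>2)"
proof -
  define x where "x = exp \<epsilon>"
  have x: "x > 1" using assms by (simp add: x_def)
  have small: "\<alpha> < 1/2 - \<delta>" using lt x unfolding x_def by linarith
  \<comment> \<open>Above \<alpha> because farness is strict, at most \<open>2 * \<alpha>\<close> to
    keep the divergence small, and at most \<open>1/2 - \<delta>\<close> so that \<open>a'\<close>
    is nonnegative.\<close>
  define \<alpha>' where "\<alpha>' = min (2 * \<alpha>) (1/2 - \<delta>)"
  have \<alpha>': "\<alpha> < \<alpha>'" "\<alpha>' \<le> 2 * \<alpha>" "\<alpha>' \<le> 1/2 - \<delta>"
    using small \<open>\<alpha> > 0\<close> by (auto simp: \<alpha>'_def)
  define a' where "a' = a - \<alpha>' / x"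
  have xa: "x * a = 1/2 - \<delta>" using x by (simp add: a_def x_def)
  have xa': "x * a' = 1/2 - \<delta> - \<alpha>'"
    using x by (simp add: a'_def right_diff_distrib xa)
  have a_pos: "a > 0" using small \<open>\<alpha> > 0\<close> by (simp add: a_def)
  have a_lt: "a < 1/2"
  proof -
    have "a \<le> x * a" using x a_pos by simp
    thus ?thesis using xa \<open>\<delta> > 0\<close> by linarith
  qed
  have a'0: "a' \<ge> 0"
    using xa' \<alpha>'(3) x by (metis diff_ge_0_iff_ge less_trans mult_less_cancel_left_pos mult_zero_right not_le zero_less_one)
  have a'1: "a' \<le> 1"
  proof -
    have "0 \<le> \<alpha>' / x" using \<alpha>' \<open>\<alpha> > 0\<close> x by simp
    thus ?thesis using a_lt unfolding a'_def by linarith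
  qed
  let ?Y = "(two_point a, two_point (1/2))" and ?N = "(two_point a', two_point (1/2))"
  have alg: "two_db_algorithm n ?Y" "two_db_algorithm n ?N"
    using set_two_point n by (fastforce simp: two_db_algorithm_def)+
  \<comment> \<open>The constraint for the event \<open>{2}\<close> in the opposite direction;
    multiplying by \<open>x\<close> removes the division in \<open>a\<close> and leaves a completed
    square.\<close>
  have low: "(1 - a) - x / 2 \<le> \<delta>"
  proof -
    have "x * ((1 - a) - x / 2 - \<delta>) = - ((x - 1)\<^sup>2 / 2 + (x - 1) * \<delta>)"
      using xa by (simp add: field_simps power2_eq_square)
    also have "\<dots> \<le> 0"
      unfolding neg_le_0_iff_le using x \<open>\<delta> > 0\<close>
      by (intro add_nonneg_nonneg mult_nonneg_nonneg) auto
    finally have "(1 - a) - x / 2 - \<delta> \<le> 0" using x by (simp add: mult_le_0_iff)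
    thus ?thesis by simp
  qed
  have xa1: "x * (1 - a) \<ge> 1/2"
  proof -
    have "1 - a \<le> x * (1 - a)" using x a_lt by simp
    thus ?thesis using a_lt by linarith
  qed
  have "is_adp n \<epsilon> \<delta> ?Y"
    unfolding is_adp_def adp_delta_le_iff
    using a_pos a_lt xa low x xa1 \<open>\<delta> > 0\<close>
    by (auto simp: prob_two_point x_def[symmetric] algebra_simps)
  hence Y: "pmf (run_tester r T ?Y) False \<le> 1/3"
    using T alg pmf_bool_False[of "run_tester r T ?Y"] by (force simp: adp_tester_def)
  have "far_from_adp n \<epsilon> \<delta> \<alpha> ?N"
  proof -
    have "{1} \<subseteq> {1..n}" using n by auto
    from adp_delta_ge(2)[OF this, of ?N \<epsilon>]
    show ?thesis unfolding far_from_adp_def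
      using a'0 a'1 xa' \<alpha>' by (simp add: prob_two_point x_def[symmetric])
  qed
  hence N: "pmf (run_tester r T ?N) False \<ge> 2/3"
    using T alg by (auto simp: adp_tester_def)
  define g where "g = verdict_prob r T (two_point (1/2)) False"
  let ?U = "{1, 2 :: nat}"
  have run: "pmf (run_tester r T (two_point b, two_point (1/2))) False = mean ?U (pmf (two_point b)) r g" for b
    using pmf_run_tester[of ?U "(two_point b, two_point (1/2))"] set_two_point by (simp add: g_def)
  define s where "s = (\<alpha>' / x)\<^sup>2 / (a * (1 - a))"
  have s0: "s \<ge> 0" using a_pos a_lt by (simp add: s_def)
  have C: "(\<Sum>i\<in>?U. (pmf (two_point a') i)\<^sup>2 / pmf (two_point a) i) = 1 + s"
  proof -
    have "(a - t)\<^sup>2 / a + (1 - (a - t))\<^sup>2 / (1 - a) = 1 + t\<^sup>2 / (a * (1 - a))" for t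
      using a_pos a_lt by (simp add: field_simps power2_eq_square)
    from this[of "\<alpha>' / x"] show ?thesis
      using a_pos a_lt a'0 a'1 by (simp add: pmf_two_point s_def a'_def[symmetric])
  qed
  \<comment> \<open>As \<open>g\<close> takes values in \<open>[0,1]\<close>, its second moment
    under \<open>a\<close> is at most its mean, hence at most 1/3.\<close>
  have "(2/3)\<^sup>2 \<le> (mean ?U (pmf (two_point a')) r g)\<^sup>2"
    using N unfolding run by (intro power_mono) auto
  also have "\<dots> \<le> (1 + s) ^ r * mean ?U (pmf (two_point a)) r (\<lambda>xs. (g xs)\<^sup>2)"
    unfolding C[symmetric] using a_pos a_lt
    by (intro mean_square_le) (auto simp: pmf_two_point)
  also have "\<dots> \<le> (1 + s) ^ r * mean ?U (pmf (two_point a)) r g"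
    using s0 verdict_prob_bounds by (intro mult_left_mono mean_mono) (auto simp: g_def power2_eq_square mult_left_le)
  also have "\<dots> \<le> (1 + s) ^ r * (1/3)"
    using Y s0 unfolding run by (intro mult_left_mono) auto
  also have "\<dots> \<le> exp (real r * s) * (1/3)"
    unfolding exp_of_nat_mult using s0 by (intro mult_right_mono power_mono exp_ge_add_one_self) auto
  finally have "4/3 \<le> exp (real r * s)" by (simp add: power2_eq_square)
  hence "ln (4/3) \<le> real r * s" by (metis exp_ge_zero ln_exp ln_mono order.strict_trans2 zero_less_divide_iff zero_less_numeral)
  also have "\<dots> \<le> real r * (4 * \<alpha>\<^sup>2 / (a * (1 - a)))"
  proof -
    have "\<alpha>' / x \<le> 2 * \<alpha>"
      using \<alpha>' x \<open>\<alpha> > 0\<close> by (smt (verit) divide_le_eq mult_le_cancel_left1)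
    hence "(\<alpha>' / x)\<^sup>2 \<le> (2 * \<alpha>)\<^sup>2"
      using x \<alpha>' \<open>\<alpha> > 0\<close> by (intro power_mono) auto
    thus ?thesis unfolding s_def using a_pos a_lt
      by (intro mult_left_mono divide_right_mono) (auto simp: power_mult_distrib)
  qed
  finally show ?thesis
    using a_pos a_lt \<open>\<alpha> > 0\<close> by (simp add: field_simps)
qed

section \<open>Randomly permuted blocks\<close>

text \<open>Up to the factor \<open>fact (card S)\<close>, a mixed moment of the entries that a
  uniformly random permutation of \<open>p\<close> places at the positions in
  \<open>D\<close>.\<close>

definition perm_moment :: "('a \<Rightarrow> real) \<Rightarrow> 'a set \<Rightarrow> 'a set \<Rightarrow> ('a \<Rightarrow> nat) \<Rightarrow> real" where
  "perm_moment p S D a = (\<Sum>\<sigma> | \<sigma> permutes S. \<Prod>d\<in>D. p (\<sigma> d) ^ a d)"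

text \<open>
  Averaging over the image of the new point \<open>d\<close> gives a full power sum, except that the images of \<open>D\<close>
  are excluded; excluding the image of \<open>e\<close> amounts to moving the exponent of \<open>d\<close> onto \<open>e\<close>.
\<close>

lemma perm_moment_insert:
  assumes S: "finite S" "insert d D \<subseteq> S" and d: "d \<notin> D"
  shows "real (card (S - D)) * perm_moment p S (insert d D) a =
    (\<Sum>i\<in>S. p i ^ a d) * perm_moment p S D a - (\<Sum>e\<in>D. perm_moment p S D (a(e := a e + a d)))"
proof -
  define R where "R \<sigma> = (\<Prod>e\<in>D. p (\<sigma> e) ^ a e)" for \<sigma>
  have D: "finite D" "D \<subseteq> S" using S finite_subset by auto
  \<comment> \<open>Composing with the transposition of \<open>d\<close> and \<open>e\<close> fixes
    \<open>D\<close> pointwise, so every position outside \<open>D\<close> gives the same sum as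
    \<open>d\<close>.\<close>
  have swap: "(\<Sum>\<sigma> | \<sigma> permutes S. p (\<sigma> e) ^ a d * R \<sigma>) = perm_moment p S (insert d D) a"
    if e: "e \<in> S - D" for e
  proof -
    let ?t = "Transposition.transpose d e"
    have t: "?t permutes S" using e S by (intro permutes_swap_id) auto
    have R: "R (\<sigma> \<circ> ?t) = R \<sigma>" for \<sigma>
      unfolding R_def using e d by (intro prod.cong refl) (auto simp: Transposition.transpose_def)
    have "(\<Sum>\<sigma> | \<sigma> permutes S. p (\<sigma> e) ^ a d * R \<sigma>) = (\<Sum>\<sigma> | \<sigma> permutes S. p (\<sigma> d) ^ a d * R \<sigma>)"
      by (subst sum_permutations_compose_right[OF t]) (simp add: R)
    thus ?thesis using D d by (simp add: perm_moment_def R_def)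
  qed
  have merge: "p (\<sigma> e) ^ a d * R \<sigma> = (\<Prod>x\<in>D. p (\<sigma> x) ^ (a(e := a e + a d)) x)" if "e \<in> D" for \<sigma> e
    unfolding R_def prod.remove[OF D(1) that]
    by (simp add: power_add)
  have total: "(\<Sum>e\<in>S. p (\<sigma> e) ^ a d) = (\<Sum>i\<in>S. p i ^ a d)" if "\<sigma> permutes S" for \<sigma>
    using sum.permute[OF that, of "\<lambda>i. p i ^ a d"] by (simp add: o_def)
  have "real (card (S - D)) * perm_moment p S (insert d D) a =
      (\<Sum>e\<in>S - D. \<Sum>\<sigma> | \<sigma> permutes S. p (\<sigma> e) ^ a d * R \<sigma>)"
    using swap by simp
  also have "\<dots> = (\<Sum>\<sigma> | \<sigma> permutes S. (\<Sum>e\<in>S - D. p (\<sigma> e) ^ a d) * R \<sigma>)"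
    by (subst sum.swap) (simp add: sum_distrib_right)
  also have "\<dots> = (\<Sum>\<sigma> | \<sigma> permutes S. (\<Sum>i\<in>S. p i ^ a d) * R \<sigma> - (\<Sum>e\<in>D. p (\<sigma> e) ^ a d * R \<sigma>))"
    using S D by (intro sum.cong refl) (simp add: sum_diff total left_diff_distrib sum_distrib_right)
  also have "\<dots> = (\<Sum>i\<in>S. p i ^ a d) * perm_moment p S D a -
      (\<Sum>\<sigma> | \<sigma> permutes S. \<Sum>e\<in>D. p (\<sigma> e) ^ a d * R \<sigma>)"
    by (simp add: sum_subtractf sum_distrib_left perm_moment_def R_def)
  also have "(\<Sum>\<sigma> | \<sigma> permutes S. \<Sum>e\<in>D. p (\<sigma> e) ^ a d * R \<sigma>) =
      (\<Sum>e\<in>D. perm_moment p S D (a(e := a e + a d)))"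
    by (subst sum.swap) (simp add: merge perm_moment_def)
  finally show ?thesis .
qed

text \<open>Induction on \<open>D\<close> by \<open>perm_moment_insert\<close>, which reduces to a
  power sum and to moments over a smaller set without raising the total exponent. Exponents move
  between points, so \<open>a\<close> must be generalised.\<close>

lemma perm_moment_eq:
  assumes S: "finite S"
    and power_sums: "\<And>j. 1 \<le> j \<Longrightarrow> j \<le> K \<Longrightarrow> (\<Sum>i\<in>S. p i ^ j) = (\<Sum>i\<in>S. q i ^ j)"
    and D: "finite D" "D \<subseteq> S" "\<And>d. d \<in> D \<Longrightarrow> 1 \<le> a d" "sum a D \<le> K"
  shows "perm_moment p S D a = perm_moment q S D a"
  using D
proof (induction D arbitrary: a rule: finite_induct)
  case (insert d D)
  have "a d \<le> K" using insert.prems(3) insert.hyps by simp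
  hence 1: "(\<Sum>i\<in>S. p i ^ a d) = (\<Sum>i\<in>S. q i ^ a d)"
    using insert.prems(2)[of d] by (intro power_sums) auto
  have 2: "perm_moment p S D a = perm_moment q S D a"
    using insert.prems insert.hyps by (intro insert.IH) auto
  have 3: "perm_moment p S D (a(e := a e + a d)) = perm_moment q S D (a(e := a e + a d))" if e: "e \<in> D" for e
  proof (rule insert.IH)
    have "sum (a(e := a e + a d)) D = a e + a d + sum a (D - {e})"
      using e insert.hyps by (simp add: sum.remove)
    also have "\<dots> = sum a (insert d D)"
      using e insert.hyps by (simp add: sum.remove[of D e])
    finally show "sum (a(e := a e + a d)) D \<le> K" using insert.prems by simp
    fix x assume "x \<in> D"
    thus "1 \<le> (a(e := a e + a d)) x"
      using insert.prems(2)[of x] by (cases "x = e") auto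
  qed (use insert.prems in auto)
  have "card (S - D) \<noteq> 0" using insert.prems insert.hyps S by auto
  moreover have "real (card (S - D)) * perm_moment p S (insert d D) a =
      real (card (S - D)) * perm_moment q S (insert d D) a"
    using insert.prems(1) insert.hyps by (simp add: perm_moment_insert S 1 2 3)
  ultimately show ?case by simp
qed (simp add: perm_moment_def)

lemma prod_list_map_eq_prod_count:
  fixes f :: "'a \<Rightarrow> real"
  shows "prod_list (map f zs) = (\<Prod>z\<in>set zs. f z ^ count_list zs z)"
  using image_prod_mset_multiplicity[of f "mset zs"]
  by (simp add: prod_mset_prod_list count_mset flip: mset_map)

text \<open>Collecting equal letters turns a word into a moment over its set of letters, with the
  multiplicities as exponents; these add up to the length of the word.\<close>

lemma perm_word_eq:
  fixes p q :: "'a \<Rightarrow> real"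
  assumes S: "finite S"
    and power_sums: "\<And>j. 1 \<le> j \<Longrightarrow> j \<le> K \<Longrightarrow> (\<Sum>i\<in>S. p i ^ j) = (\<Sum>i\<in>S. q i ^ j)"
    and zs: "set zs \<subseteq> S" "length zs \<le> K"
  shows "(\<Sum>\<sigma> | \<sigma> permutes S. prod_list (map (\<lambda>z. p (\<sigma> z)) zs)) =
    (\<Sum>\<sigma> | \<sigma> permutes S. prod_list (map (\<lambda>z. q (\<sigma> z)) zs))"
  unfolding prod_list_map_eq_prod_count perm_moment_def[symmetric]
  by (rule perm_moment_eq[OF S power_sums])
     (use zs in \<open>auto simp: sum_count_set Suc_le_eq count_list_0_iff simp flip: neq0_conv\<close>)

section \<open>Independent permutations of many blocks and collision counts\<close>

definition hits :: "('a \<Rightarrow> nat) \<Rightarrow> nat \<Rightarrow> 'a list \<Rightarrow> 'a list" where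
  "hits blk b xs = filter (\<lambda>x. blk x = b) xs"

lemma prod_list_blocks:
  fixes f :: "'a \<Rightarrow> real"
  assumes "\<And>x. x \<in> set xs \<Longrightarrow> blk x < m"
  shows "prod_list (map f xs) = (\<Prod>b<m. prod_list (map f (hits blk b xs)))"
  using assms
proof (induction xs)
  case (Cons x xs)
  have "prod_list (map f (hits blk b (x # xs))) =
      (if b = blk x then f x else 1) * prod_list (map f (hits blk b xs))" for b
    by (auto simp: hits_def)
  thus ?case using Cons by (simp add: prod.distrib)
qed (simp add: hits_def)

text \<open>The permutations of different blocks are chosen independently, so the sum over all
  choices factors into one sum per block, to which \<open>perm_word_eq\<close> applies.\<close>

lemma block_perm_word_eq:
  fixes p q :: "'i \<Rightarrow> real"
  defines "\<Omega> m S \<equiv> PiE {..<m} (\<lambda>_. {\<sigma>. \<sigma> permutes S})"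
  assumes S: "finite S"
    and power_sums: "\<And>j. 1 \<le> j \<Longrightarrow> j \<le> K \<Longrightarrow> (\<Sum>i\<in>S. p i ^ j) = (\<Sum>i\<in>S. q i ^ j)"
    and xs: "\<And>x. x \<in> set xs \<Longrightarrow> blk x < m \<and> pos x \<in> S"
    and few: "\<And>b. b < m \<Longrightarrow> length (hits blk b xs) \<le> K"
  shows "(\<Sum>\<pi>\<in>\<Omega> m S. prod_list (map (\<lambda>x. p (\<pi> (blk x) (pos x))) xs)) =
    (\<Sum>\<pi>\<in>\<Omega> m S. prod_list (map (\<lambda>x. q (\<pi> (blk x) (pos x))) xs))"
proof -
  have split: "(\<Sum>\<pi>\<in>\<Omega> m S. prod_list (map (\<lambda>x. f (\<pi> (blk x) (pos x))) xs)) =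
      (\<Prod>b<m. \<Sum>\<sigma> | \<sigma> permutes S. prod_list (map (\<lambda>z. f (\<sigma> z)) (map pos (hits blk b xs))))"
    for f :: "'i \<Rightarrow> real"
  proof -
    have "prod_list (map (\<lambda>x. f (\<pi> (blk x) (pos x))) xs) =
        (\<Prod>b<m. prod_list (map (\<lambda>z. f (\<pi> b z)) (map pos (hits blk b xs))))" for \<pi>
      by (subst prod_list_blocks[of xs blk m], use xs in blast,
          intro prod.cong refl arg_cong[where f = prod_list]) (auto simp: hits_def)
    thus ?thesis unfolding \<Omega>_def using S
      by (simp add: prod_sum_PiE finite_permutations)
  qed
  show ?thesis unfolding split
    by (intro prod.cong refl perm_word_eq[OF S power_sums])
       (use xs few in \<open>auto simp: hits_def\<close>)
qed

text \<open>The factorial moment of a binomial count: each of the \<open>r choose k\<close> sets of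
  positions falls entirely into block \<open>b\<close> with probability
  \<open>t ^ k\<close>.\<close>

lemma mean_choose_hits:
  assumes U: "finite U" and w: "sum w U = 1" and t: "(\<Sum>x | x \<in> U \<and> blk x = b. w x) = t"
  shows "mean U w r (\<lambda>xs. real (length (hits blk b xs) choose k)) = real (r choose k) * t ^ k"
proof (induction r arbitrary: k)
  case 0
  show ?case by (cases k) (auto simp: hits_def)
next
  case (Suc r)
  let ?N = "\<lambda>xs k. real (length (hits blk b xs) choose k)"
  show ?case
  proof (cases k)
    case 0
    thus ?thesis using Suc[of 0] w by (simp add: mean_Suc)
  next
    case (Suc k')
    \<comment> \<open>Split off the first letter: if it lies in block \<open>b\<close>, the count
      grows by one and Pascal's rule applies.\<close>
    have "mean U w (Suc r) (\<lambda>xs. ?N xs k) =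
        (\<Sum>x\<in>U. w x * mean U w r (\<lambda>xs. ?N xs k + of_bool (blk x = b) * ?N xs k'))"
      unfolding mean_Suc by (intro sum.cong refl arg_cong2[where f = "(*)"] arg_cong[where f = "mean U w r"])
        (auto simp: hits_def Suc fun_eq_iff)
    also have "\<dots> = (\<Sum>x\<in>U. w x * (real (r choose k) * t ^ k) +
        (w x * of_bool (blk x = b)) * (real (r choose k') * t ^ k'))"
      by (simp add: mean_add_mult Suc.IH algebra_simps)
    also have "\<dots> = real (r choose k) * t ^ k + (\<Sum>x\<in>U. w x * of_bool (blk x = b)) * (real (r choose k') * t ^ k')"
      by (simp add: sum.distrib w flip: sum_distrib_right)
    also have "(\<Sum>x\<in>U. w x * of_bool (blk x = b)) = t"
      unfolding t[symmetric] using U by (simp add: of_bool_def if_distrib sum.If_cases Int_def cong: if_cong)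
    finally show ?thesis by (simp add: Suc algebra_simps)
  qed
qed

text \<open>The assumption \<open>block\<close> expresses through sums that \<open>pos\<close>
  enumerates \<open>S\<close> once within each block; permuting \<open>S\<close> then preserves the
  block total.\<close>

lemma sum_one_block:
  fixes f :: "'i \<Rightarrow> real"
  assumes block: "\<And>b f. b < m \<Longrightarrow> (\<Sum>x | x \<in> U \<and> blk x = b. f (pos x)) = (\<Sum>i\<in>S. f i :: real)"
    and b: "b < m" and \<pi>: "\<pi> b permutes S"
  shows "(\<Sum>x | x \<in> U \<and> blk x = b. f (\<pi> (blk x) (pos x))) = (\<Sum>i\<in>S. f i)"
proof -
  have "(\<Sum>x | x \<in> U \<and> blk x = b. f (\<pi> (blk x) (pos x))) = (\<Sum>x | x \<in> U \<and> blk x = b. f (\<pi> b (pos x)))"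
    by (intro sum.cong) auto
  also have "\<dots> = (\<Sum>i\<in>S. f (\<pi> b i))" by (rule block[OF b])
  also have "\<dots> = (\<Sum>i\<in>S. f i)" using sum.permute[OF \<pi>, of f] by (simp add: o_def)
  finally show ?thesis .
qed

lemma sum_all_blocks:
  fixes f :: "'i \<Rightarrow> real"
  assumes U: "finite U" "\<And>x. x \<in> U \<Longrightarrow> blk x < m"
    and block: "\<And>b f. b < m \<Longrightarrow> (\<Sum>x | x \<in> U \<and> blk x = b. f (pos x)) = (\<Sum>i\<in>S. f i :: real)"
    and \<pi>: "\<And>b. b < m \<Longrightarrow> \<pi> b permutes S"
  shows "(\<Sum>x\<in>U. f (\<pi> (blk x) (pos x))) = real m * (\<Sum>i\<in>S. f i)"
proof -
  have "(\<Sum>x\<in>U. f (\<pi> (blk x) (pos x))) = (\<Sum>b<m. \<Sum>x | x \<in> U \<and> blk x = b. f (\<pi> (blk x) (pos x)))"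
    using U by (intro sum.group[symmetric]) auto
  also have "\<dots> = (\<Sum>b<m. \<Sum>i\<in>S. f i)"
    by (intro sum.cong refl sum_one_block[OF block]) (use \<pi> in auto)
  finally show ?thesis by simp
qed

text \<open>After averaging over the permutations, words with at most \<open>K\<close> hits in every
  block have equal weight under \<open>p\<close> and \<open>q\<close>. The advantage of
  \<open>g\<close> is thus at most the probability under \<open>p\<close> of more than
  \<open>K\<close> hits in some block, each block having mass \<open>1 / m\<close>.\<close>

lemma block_perm_indistinguishable:
  fixes p q :: "'i \<Rightarrow> real" and g :: "'a list \<Rightarrow> real"
  defines "\<Omega> m S \<equiv> PiE {..<m} (\<lambda>_. {\<sigma>. \<sigma> permutes S})"
  assumes U: "finite U" and S: "finite S" and m: "m > 0" and K: "K \<ge> 1"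
    and coords: "\<And>x. x \<in> U \<Longrightarrow> blk x < m \<and> pos x \<in> S"
    and block: "\<And>b f. b < m \<Longrightarrow> (\<Sum>x | x \<in> U \<and> blk x = b. f (pos x)) = (\<Sum>i\<in>S. f i :: real)"
    and p: "\<And>i. 0 \<le> p i" and q: "\<And>i. 0 \<le> q i" and p_sum: "(\<Sum>i\<in>S. p i) = 1 / real m"
    and power_sums: "\<And>j. 1 \<le> j \<Longrightarrow> j \<le> K \<Longrightarrow> (\<Sum>i\<in>S. p i ^ j) = (\<Sum>i\<in>S. q i ^ j)"
    and g: "\<And>xs. 0 \<le> g xs" "\<And>xs. g xs \<le> 1"
    and mp: "\<And>\<pi>. \<pi> \<in> \<Omega> m S \<Longrightarrow> mean U (\<lambda>x. p (\<pi> (blk x) (pos x))) r g \<ge> u"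
    and mq: "\<And>\<pi>. \<pi> \<in> \<Omega> m S \<Longrightarrow> mean U (\<lambda>x. q (\<pi> (blk x) (pos x))) r g \<le> v"
  shows "u - v \<le> real r ^ Suc K / real m ^ K"
proof -
  define W where "W f \<pi> xs = prod_list (map (\<lambda>x. f (\<pi> (blk x) (pos x))) xs)" for f :: "'i \<Rightarrow> real" and \<pi> xs
  define bad where "bad xs \<longleftrightarrow> (\<exists>b<m. length (hits blk b xs) > K)" for xs
  let ?\<Omega> = "\<Omega> m S"
  have fin: "finite ?\<Omega>" unfolding \<Omega>_def using S by (intro finite_PiE) (auto simp: finite_permutations)
  have "(\<lambda>b\<in>{..<m}. id) \<in> ?\<Omega>" by (auto simp: \<Omega>_def permutes_id)
  hence pos: "card ?\<Omega> > 0" using fin by (auto simp: card_gt_0_iff)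
  have W0: "0 \<le> W f \<pi> xs" if "\<And>i. 0 \<le> f i" for f \<pi> xs
    unfolding W_def using that by (intro prod_list_map_nonneg) auto
  have "real (card ?\<Omega>) * (u - v) \<le> (\<Sum>\<pi>\<in>?\<Omega>. (\<Sum>xs\<in>words U r. W p \<pi> xs * g xs)
      - (\<Sum>xs\<in>words U r. W q \<pi> xs * g xs))"
    using mp mq by (intro sum_bounded_below diff_mono) (auto simp: mean_def W_def)
  also have "\<dots> = (\<Sum>xs\<in>words U r. g xs * ((\<Sum>\<pi>\<in>?\<Omega>. W p \<pi> xs) - (\<Sum>\<pi>\<in>?\<Omega>. W q \<pi> xs)))"
    unfolding sum_subtractf
    by (subst (1 2) sum.swap[of _ "words U r"])
       (simp add: right_diff_distrib sum_subtractf sum_distrib_left mult_ac)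
  \<comment> \<open>Good words cancel; on bad words the \<open>q\<close> part is dropped and
    \<open>g\<close> is bounded by 1.\<close>
  also have "\<dots> \<le> (\<Sum>xs\<in>words U r. of_bool (bad xs) * (\<Sum>\<pi>\<in>?\<Omega>. W p \<pi> xs))"
  proof (intro sum_mono)
    fix xs assume xs: "xs \<in> words U r"
    show "g xs * ((\<Sum>\<pi>\<in>?\<Omega>. W p \<pi> xs) - (\<Sum>\<pi>\<in>?\<Omega>. W q \<pi> xs)) \<le> of_bool (bad xs) * (\<Sum>\<pi>\<in>?\<Omega>. W p \<pi> xs)"
    proof (cases "bad xs")
      case False
      have few: "length (hits blk b xs) \<le> K" if "b < m" for b
        using False that unfolding bad_def by (meson not_le)
      have "(\<Sum>\<pi>\<in>?\<Omega>. W p \<pi> xs) = (\<Sum>\<pi>\<in>?\<Omega>. W q \<pi> xs)"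
        unfolding W_def \<Omega>_def
        by (rule block_perm_word_eq[OF S power_sums])
           (use few xs coords in \<open>auto simp: words_def\<close>)
      thus ?thesis using False by simp
    next
      case True
      have *: "0 \<le> (\<Sum>\<pi>\<in>?\<Omega>. W p \<pi> xs)" "0 \<le> (\<Sum>\<pi>\<in>?\<Omega>. W q \<pi> xs)"
        using W0 p q by (auto intro!: sum_nonneg)
      have "g xs * ((\<Sum>\<pi>\<in>?\<Omega>. W p \<pi> xs) - (\<Sum>\<pi>\<in>?\<Omega>. W q \<pi> xs)) \<le> g xs * (\<Sum>\<pi>\<in>?\<Omega>. W p \<pi> xs)"
        using * g by (intro mult_left_mono) auto
      also have "\<dots> \<le> 1 * (\<Sum>\<pi>\<in>?\<Omega>. W p \<pi> xs)"
        using * g by (intro mult_right_mono) auto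
      finally show ?thesis using True by simp
    qed
  qed
  also have "\<dots> = (\<Sum>\<pi>\<in>?\<Omega>. \<Sum>xs\<in>words U r. W p \<pi> xs * of_bool (bad xs))"
    by (subst sum.swap) (simp add: sum_distrib_left mult_ac)
  also have "\<dots> \<le> (\<Sum>\<pi>\<in>?\<Omega>. real r ^ Suc K / real m ^ K)"
  proof (intro sum_mono)
    fix \<pi> assume \<pi>: "\<pi> \<in> ?\<Omega>"
    let ?w = "\<lambda>x. p (\<pi> (blk x) (pos x))"
    have perm: "\<pi> b permutes S" if "b < m" for b using \<pi> that by (auto simp: \<Omega>_def)
    have blk: "(\<Sum>x | x \<in> U \<and> blk x = b. ?w x) = 1 / real m" if b: "b < m" for b
      unfolding p_sum[symmetric] by (rule sum_one_block) (fact block b perm[OF b])+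
    have "sum ?w U = real m * (\<Sum>i\<in>S. p i)"
      by (rule sum_all_blocks[where pos = pos and blk = blk and \<pi> = \<pi> and f = p,
            OF U coords[THEN conjunct1]]) (assumption | fact block perm)+
    hence w: "sum ?w U = 1" using p_sum m by simp
    \<comment> \<open>Union bound: a block with more than \<open>K\<close> hits contributes at least
      1 to the sum of binomial coefficients, whose mean is known exactly.\<close>
    have "(\<Sum>xs\<in>words U r. W p \<pi> xs * of_bool (bad xs)) \<le>
        mean U ?w r (\<lambda>xs. \<Sum>b<m. real (length (hits blk b xs) choose Suc K))"
      unfolding mean_def W_def[symmetric]
    proof (intro sum_mono mult_left_mono W0 p)
      fix xs
      show "of_bool (bad xs) \<le> (\<Sum>b<m. real (length (hits blk b xs) choose Suc K))"
      proof (cases "bad xs")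
        case True
        then obtain b where b: "b < m" "length (hits blk b xs) > K" by (auto simp: bad_def)
        have "1 \<le> real (length (hits blk b xs) choose Suc K)"
          using b by (simp add: Suc_le_eq zero_less_binomial_iff)
        also have "\<dots> \<le> (\<Sum>b<m. real (length (hits blk b xs) choose Suc K))"
          using b by (intro member_le_sum) auto
        finally show ?thesis using True by simp
      qed (simp add: sum_nonneg)
    qed
    also have "\<dots> = (\<Sum>b<m. mean U ?w r (\<lambda>xs. real (length (hits blk b xs) choose Suc K)))"
      unfolding mean_def by (subst sum.swap) (simp add: sum_distrib_left)
    also have "\<dots> = (\<Sum>b<m. real (r choose Suc K) * (1 / real m) ^ Suc K)"
      using mean_choose_hits[OF U w blk] by simp
    also have "\<dots> = real (r choose Suc K) / real m ^ K"
      using m by (simp add: power_divide)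
    also have "\<dots> \<le> real r ^ Suc K / real m ^ K"
    proof (intro divide_right_mono)
      have "r choose Suc K \<le> r ^ Suc K"
        by (metis binomial_eq_0 binomial_le_pow not_le zero_le)
      thus "real (r choose Suc K) \<le> real r ^ Suc K" by (metis of_nat_le_iff of_nat_power)
    qed auto
    finally show "(\<Sum>xs\<in>words U r. W p \<pi> xs * of_bool (bad xs)) \<le> real r ^ Suc K / real m ^ K" .
  qed
  also have "\<dots> = real (card ?\<Omega>) * (real r ^ Suc K / real m ^ K)" by simp
  finally show ?thesis using pos by (simp only: mult_le_cancel_left)
qed

section \<open>Patterns with equal power sums\<close>

definition power_sum :: "nat list \<Rightarrow> nat \<Rightarrow> nat" where
  "power_sum X j = sum_list (map (\<lambda>y. y ^ j) X)"

definition scale_merge :: "nat \<Rightarrow> nat \<Rightarrow> nat list \<Rightarrow> nat list \<Rightarrow> nat list" where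
  "scale_merge c M X Y = concat (replicate c X) @ map ((*) M) Y"

text \<open>
  With \<open>c = M ^ (k + 1)\<close>, the pair \<open>scale_merge c M X Y\<close>, \<open>scale_merge c M Y X\<close> keeps the equal power
  sums of \<open>X\<close> and \<open>Y\<close> and gains equality at \<open>k + 1\<close>, since the difference of the \<open>j\<close>-th power sums is
  multiplied by \<open>c - M ^ j\<close>. The rescaled copy carries only a small share of the mass if \<open>M\<close> is large.
\<close>

lemma power_sum_scale_merge:
  "power_sum (scale_merge c M X Y) j = c * power_sum X j + M ^ j * power_sum Y j"
proof -
  have "power_sum (concat (replicate c X)) j = c * power_sum X j"
    by (induction c) (auto simp: power_sum_def)
  moreover have "power_sum (map ((*) M) Y) j = M ^ j * power_sum Y j"
    by (simp add: power_sum_def o_def power_mult_distrib sum_list_const_mult)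
  ultimately show ?thesis by (simp add: scale_merge_def power_sum_def)
qed

lemma count_list_scale_merge: "c * count_list X y \<le> count_list (scale_merge c M X Y) y"
proof -
  have "count_list (concat (replicate c X)) y = c * count_list X y"
    by (induction c) auto
  thus ?thesis by (simp add: scale_merge_def)
qed

text \<open>Entries are frequencies, and the first power sum is the total mass. All but a share
  \<gamma> of it lies on ones in \<open>X\<close> and on twos in \<open>Y\<close>: read as
  distributions, nearly uniform on everything and on half of the domain. Induction starts from
  \<open>[1, 1]\<close> and \<open>[2]\<close> and merges rescaled copies crosswise.\<close>

lemma patterns_exist:
  fixes \<gamma> :: real
  assumes "\<gamma> > 0"
  shows "\<exists>X Y. 0 \<notin> set X \<and> 0 \<notin> set Y \<and> X \<noteq> [] \<and>
    (\<forall>j. 1 \<le> j \<and> j \<le> Suc k \<longrightarrow> power_sum X j = power_sum Y j) \<and>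
    (1 - \<gamma>) * power_sum X 1 \<le> count_list X 1 \<and>
    (1 - \<gamma>) * power_sum Y 1 \<le> 2 * count_list Y 2"
  using assms
proof (induction k arbitrary: \<gamma>)
  case 0
  show ?case
  proof (intro exI conjI)
    show "\<forall>j. 1 \<le> j \<and> j \<le> Suc 0 \<longrightarrow> power_sum [1, 1] j = power_sum [2] j"
      by (auto simp: power_sum_def le_Suc_eq)
  qed (use 0 in \<open>auto simp: power_sum_def\<close>)
next
  case (Suc k)
  have "\<gamma> / 2 > 0" using Suc.prems by simp
  from Suc.IH[OF this] obtain X Y where XY: "0 \<notin> set X" "0 \<notin> set Y" "X \<noteq> []"
      and eq: "\<And>j. 1 \<le> j \<Longrightarrow> j \<le> Suc k \<Longrightarrow> power_sum X j = power_sum Y j"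
      and X1: "(1 - \<gamma> / 2) * power_sum X 1 \<le> count_list X 1"
      and Y1: "(1 - \<gamma> / 2) * power_sum Y 1 \<le> 2 * count_list Y 2"
    by blast
  \<comment> \<open>Since \<open>c\<close> is at least \<open>M * M\<close>, the rescaled copy has
    mass at most \<gamma>/2 times that of the \<open>c\<close> plain copies, which is the loss
    allowed on top of the \<gamma>/2 from the induction.\<close>
  obtain M :: nat where M: "real M > 2 / \<gamma>" using reals_Archimedean2 by blast
  have M0: "M > 0"
  proof -
    have "0 < 2 / \<gamma>" using Suc.prems by simp
    hence "0 < real M" using M by linarith
    thus ?thesis by simp
  qed
  define c where "c = M ^ Suc (Suc k)"
  have "M ^ 2 \<le> c" unfolding c_def using M0 by (intro power_increasing) auto
  hence cM: "real M * real M \<le> real c" by (metis of_nat_le_iff of_nat_mult power2_eq_square)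
  have fraction: "(1 - \<gamma>) * (real c + real M) \<le> real c * (1 - \<gamma> / 2)"
  proof -
    have "1 \<le> real M * \<gamma> / 2" using M Suc.prems by (simp add: field_simps)
    hence "real M * 1 \<le> real M * (real M * \<gamma> / 2)" by (intro mult_left_mono) auto
    also have "\<dots> \<le> real c * \<gamma> / 2"
      using mult_right_mono[OF cM, of "\<gamma> / 2"] Suc.prems by (simp add: mult_ac)
    finally have "real M \<le> real c * \<gamma> / 2" by simp
    moreover have "0 \<le> real M * \<gamma>" using Suc.prems by simp
    ultimately show ?thesis by (simp add: algebra_simps)
  qed
  \<comment> \<open>Stated for arbitrary \<open>A\<close> and \<open>B\<close> to serve both orders
    of merging; \<open>l\<close> is the mass of one entry \<open>y\<close>.\<close>
  have keep: "(1 - \<gamma>) * power_sum (scale_merge c M A B) 1 \<le> l * count_list (scale_merge c M A B) y"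
    if "power_sum A 1 = power_sum B 1" and A: "(1 - \<gamma> / 2) * power_sum A 1 \<le> l * count_list A y" and l: "l \<ge> 0"
    for A B y and l :: real
  proof -
    have "(1 - \<gamma>) * power_sum (scale_merge c M A B) 1 = (1 - \<gamma>) * (real c + real M) * power_sum A 1"
      using that(1) by (simp add: power_sum_scale_merge algebra_simps)
    also have "\<dots> \<le> real c * (1 - \<gamma> / 2) * power_sum A 1"
      by (intro mult_right_mono fraction) auto
    also have "\<dots> \<le> l * (real c * count_list A y)"
      using mult_left_mono[OF A, of "real c"] by (simp add: mult_ac)
    also have "\<dots> \<le> l * count_list (scale_merge c M A B) y"
      using count_list_scale_merge[of c A y M B] l
      by (intro mult_left_mono) (metis of_nat_le_iff of_nat_mult, simp)
    finally show ?thesis .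
  qed
  show ?case
  proof (intro exI conjI allI impI)
    show "0 \<notin> set (scale_merge c M X Y)" "0 \<notin> set (scale_merge c M Y X)"
      using XY M0 by (auto simp: scale_merge_def)
    show "scale_merge c M X Y \<noteq> []"
      using XY M0 by (auto simp: scale_merge_def c_def)
    show "power_sum (scale_merge c M X Y) j = power_sum (scale_merge c M Y X) j" if "1 \<le> j \<and> j \<le> Suc (Suc k)" for j
    proof (cases "j = Suc (Suc k)")
      case True
      thus ?thesis by (simp add: power_sum_scale_merge c_def)
    next
      case False
      thus ?thesis using that eq[of j] by (simp add: power_sum_scale_merge)
    qed
    show "(1 - \<gamma>) * power_sum (scale_merge c M X Y) 1 \<le> count_list (scale_merge c M X Y) 1"
      using keep[of X Y 1 1] eq[of 1] X1 by simp
    show "(1 - \<gamma>) * power_sum (scale_merge c M Y X) 1 \<le> 2 * count_list (scale_merge c M Y X) 2"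
      using keep[of Y X 2 2] eq[of 1] Y1 by simp
  qed
qed

section \<open>From patterns to distributions\<close>

text \<open>Extends a pattern by elements of probability zero to fill a block; sums of functions
  vanishing at 0, such as positive powers, do not see them.\<close>

definition padded :: "nat list \<Rightarrow> nat \<Rightarrow> nat" where
  "padded X i = (if i < length X then X ! i else 0)"

lemma sum_padded:
  fixes f :: "nat \<Rightarrow> real"
  assumes "length X \<le> L" "f 0 = 0"
  shows "(\<Sum>i<L. f (padded X i)) = sum_list (map f X)"
proof -
  have "(\<Sum>i<L. f (padded X i)) = (\<Sum>i<length X. f (padded X i))"
    using assms by (intro sum.mono_neutral_right) (auto simp: padded_def)
  also have "\<dots> = sum_list (map f X)"
    by (simp add: sum_list_sum_nth padded_def atLeast0LessThan)
  finally show ?thesis .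
qed

lemma real_power_sum: "real (power_sum X j) = sum_list (map (\<lambda>y. real y ^ j) X)"
  by (induction X) (auto simp: power_sum_def)

lemma sum_list_indicator: "sum_list (map (\<lambda>y. if y = a then b else 0) X) = b * real (count_list X a)"
  by (induction X) (auto simp: algebra_simps)

lemma length_le_power_sum: "0 \<notin> set X \<Longrightarrow> length X \<le> power_sum X 1"
  by (induction X) (auto simp: power_sum_def)

lemma pmf_of_weights_exists:
  fixes w :: "'a \<Rightarrow> real"
  assumes "finite U" "\<And>x. x \<in> U \<Longrightarrow> 0 \<le> w x" "sum w U = 1"
  obtains P where "set_pmf P \<subseteq> U" "\<And>x. x \<in> U \<Longrightarrow> pmf P x = w x"
proof -
  define f where "f x = (if x \<in> U then w x else 0)" for x
  have f: "\<And>x. 0 \<le> f x" using assms by (auto simp: f_def)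
  have "(\<integral>\<^sup>+x. ennreal (f x) \<partial>count_space UNIV) = (\<Sum>x\<in>U. ennreal (f x))"
    using assms(1) by (intro nn_integral_count_space') (auto simp: f_def)
  also have "\<dots> = ennreal (\<Sum>x\<in>U. f x)" using f by (simp add: sum_ennreal)
  also have "(\<Sum>x\<in>U. f x) = 1" using assms(3) by (simp add: f_def)
  finally have tot: "(\<integral>\<^sup>+x. ennreal (f x) \<partial>count_space UNIV) = 1" by simp
  show ?thesis
  proof
    show "set_pmf (embed_pmf f) \<subseteq> U"
      by (auto simp: set_embed_pmf[OF f tot] f_def split: if_splits)
    show "pmf (embed_pmf f) x = w x" if "x \<in> U" for x
      using that by (simp add: pmf_embed_pmf[OF f tot] f_def)
  qed
qed

text \<open>Block \<open>b\<close> consists of the numbers from \<open>b * L + 1\<close> to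
  \<open>b * L + L\<close>; the shift by one is due to the domain starting at 1.\<close>

lemma sum_div_block:
  fixes f :: "nat \<Rightarrow> real"
  assumes "b < m"
  shows "(\<Sum>x | x \<in> {1..m * L} \<and> (x - 1) div L = b. f ((x - 1) mod L)) = (\<Sum>i<L. f i)"
proof (rule sum.reindex_bij_witness[where j = "\<lambda>x. (x - 1) mod L" and i = "\<lambda>i. Suc (b * L + i)"], goal_cases)
  case (1 x)
  then show ?case using div_mult_mod_eq[of "x - 1" L] by auto
next
  case (2 x)
  then show ?case by (cases "L = 0") auto
next
  case (4 i)
  have "Suc (b * L + i) \<le> Suc b * L" using 4 by simp
  also have "\<dots> \<le> m * L" using assms by (intro mult_right_mono) auto
  finally show ?case using 4 by auto
qed auto

text \<open>Complements turn the one-sided bound into a bound in both directions, and the factor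
  \<open>exp \<epsilon> \<ge> 1\<close> only lowers the differences.\<close>

lemma is_adp_of_close:
  assumes alg: "two_db_algorithm n A" and "\<epsilon> \<ge> 0"
    and close: "\<And>E. E \<subseteq> {1..n} \<Longrightarrow> measure_pmf.prob (fst A) E - measure_pmf.prob (snd A) E \<le> \<delta>"
  shows "is_adp n \<epsilon> \<delta> A"
  unfolding is_adp_def adp_delta_le_iff
proof (intro allI impI conjI)
  fix E assume E: "E \<subseteq> {1..n}"
  let ?p = "measure_pmf.prob (fst A)" and ?q = "measure_pmf.prob (snd A)"
  have compl: "measure_pmf.prob P ({1..n} - E) = 1 - measure_pmf.prob P E" if "set_pmf P \<subseteq> {1..n}" for P :: "nat pmf"
  proof -
    have "measure_pmf.prob P {1..n} = 1" using that by (subst measure_pmf.prob_eq_1) (auto simp: AE_measure_pmf_iff)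
    thus ?thesis using E by (subst measure_pmf.finite_measure_Diff) auto
  qed
  have scale: "c \<le> exp \<epsilon> * c" if "c \<ge> 0" for c
    using that \<open>\<epsilon> \<ge> 0\<close> by (simp add: mult_le_cancel_right1)
  show "?p E - exp \<epsilon> * ?q E \<le> \<delta>"
    using close[OF E] scale[of "?q E"] by simp
  show "?q E - exp \<epsilon> * ?p E \<le> \<delta>"
    using close[of "{1..n} - E"] scale[of "?p E"] alg
    by (simp add: compl two_db_algorithm_def del: One_nat_def)
qed

section \<open>Query complexity\<close>

text \<open>Applies \<open>block_perm_indistinguishable\<close> with \<open>K = Suc k\<close> to the
  patterns \<open>X\<close> (private) and \<open>Y\<close> (far) against a uniform second database.
  The block length \<open>L\<close> is fixed before \<open>n\<close>, so the number of blocks grows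
  linearly in \<open>n\<close>.\<close>

lemma tester_power_bound:
  fixes \<epsilon> \<delta> \<alpha> :: real
  assumes "\<epsilon> > 0" "\<delta> > 0" "\<alpha> > 0" and lt: "exp \<epsilon> / 2 + \<delta> + \<alpha> < 1"
  shows "\<exists>L>0. \<forall>n\<ge>L. \<forall>r T. adp_tester n \<epsilon> \<delta> \<alpha> r T \<longrightarrow>
    1 / 3 \<le> real r ^ Suc (Suc k) / real (n div L) ^ Suc k"
proof -
  \<comment> \<open>The bound by \<delta> makes the \<open>X\<close> side private; halving the slack
    in the hypothesis keeps the \<open>Y\<close> side strictly beyond \<delta> + \<alpha>.\<close>
  define \<gamma> where "\<gamma> = min \<delta> ((1 - exp \<epsilon> / 2 - \<delta> - \<alpha>) / 2)"
  have \<gamma>: "\<gamma> > 0" "\<gamma> \<le> \<delta>" "1 - \<gamma> - exp \<epsilon> / 2 > \<delta> + \<alpha>"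
    using assms by (auto simp: \<gamma>_def min_def field_simps)
  obtain X Y where XY: "0 \<notin> set X" "0 \<notin> set Y" "X \<noteq> []"
      and eq: "\<And>j. 1 \<le> j \<Longrightarrow> j \<le> Suc k \<Longrightarrow> power_sum X j = power_sum Y j"
      and X1: "(1 - \<gamma>) * power_sum X 1 \<le> count_list X 1"
      and Y1: "(1 - \<gamma>) * power_sum Y 1 \<le> 2 * count_list Y 2"
    using patterns_exist[OF \<gamma>(1), of k] by blast
  \<comment> \<open>With block length equal to the mass of a pattern, an entry 1 becomes exactly the
    uniform probability \<open>1 / (m * L)\<close>.\<close>
  define L where "L = power_sum X 1"
  have LX: "length X \<le> L" using length_le_power_sum XY by (simp add: L_def)
  have LY: "length Y \<le> L" using length_le_power_sum[of Y] XY eq[of 1] by (simp add: L_def)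
  have L: "L > 0" using LX XY(3) by (cases X) auto
  have "1 / 3 \<le> real r ^ Suc (Suc k) / real (n div L) ^ Suc k"
    if n: "n \<ge> L" and T: "adp_tester n \<epsilon> \<delta> \<alpha> r T" for n r T
  proof -
    define m where "m = n div L"
    have m: "m > 0" using n L by (simp add: m_def div_greater_zero_iff)
    have mL: "m * L \<le> n" by (simp add: m_def)
    define U where "U = {1..m * L}"
    have U: "finite U" "U \<noteq> {}" "card U = m * L" "U \<subseteq> {1..n}" using mL m L by (auto simp: U_def)
    define blk where "blk x = (x - 1) div L" for x
    define pos where "pos x = (x - 1) mod L" for x
    have coords: "blk x < m \<and> pos x \<in> {..<L}" if "x \<in> U" for x
      using that L by (auto simp: U_def blk_def pos_def less_mult_imp_div_less)
    have block: "(\<Sum>x | x \<in> U \<and> blk x = b. f (pos x)) = (\<Sum>i\<in>{..<L}. f i)" if "b < m" for b and f :: "nat \<Rightarrow> real"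
      unfolding U_def blk_def pos_def by (rule sum_div_block[OF that])
    define \<Omega> where "\<Omega> = PiE {..<m} (\<lambda>_. {\<sigma>. \<sigma> permutes {..<L}})"
    have perm: "\<pi> b permutes {..<L}" if "\<pi> \<in> \<Omega>" "b < m" for \<pi> b
      using that by (auto simp: \<Omega>_def)
    have total: "(\<Sum>x\<in>U. f (\<pi> (blk x) (pos x))) = real m * (\<Sum>i<L. f i)" if "\<pi> \<in> \<Omega>" for \<pi> and f :: "nat \<Rightarrow> real"
      by (rule sum_all_blocks[OF U(1) coords[THEN conjunct1] block perm[OF that]])
    define p where "p Z i = real (padded Z i) / real (m * L)" for Z i
    have powers: "(\<Sum>i<L. p Z i ^ j) = real (power_sum Z j) / real (m * L) ^ j"
      if "length Z \<le> L" "j \<ge> 1" for Z j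
      using sum_padded[of Z L "\<lambda>y. real y ^ j"] that
      by (simp add: p_def power_divide real_power_sum flip: sum_divide_distrib)
    define Q where "Q = pmf_of_set U"
    have Q: "pmf Q x = (if x \<in> U then 1 / real (m * L) else 0)" for x
      using U by (simp add: Q_def indicator_def)
    have prob: "measure_pmf.prob P E = (\<Sum>x\<in>E \<inter> U. pmf P x)" if "set_pmf P \<subseteq> U" for P E
    proof -
      have "measure_pmf.prob P E = measure_pmf.prob P (E \<inter> U)"
        by (rule measure_prob_cong_0) (use that in \<open>auto simp: set_pmf_iff\<close>)
      thus ?thesis using U by (simp add: measure_measure_pmf_finite)
    qed
    have ex: "\<exists>P. set_pmf P \<subseteq> U \<and> (\<forall>x\<in>U. pmf P x = p Z (\<pi> (blk x) (pos x)))"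
      if \<pi>: "\<pi> \<in> \<Omega>" and Z: "length Z \<le> L" "power_sum Z 1 = L" for \<pi> Z
    proof -
      have "(\<Sum>x\<in>U. p Z (\<pi> (blk x) (pos x))) = 1"
        using total[OF \<pi>, of "p Z"] powers[OF Z(1), of 1] Z m L by simp
      then obtain P where "set_pmf P \<subseteq> U" "\<And>x. x \<in> U \<Longrightarrow> pmf P x = p Z (\<pi> (blk x) (pos x))"
        using pmf_of_weights_exists[OF U(1), of "\<lambda>x. p Z (\<pi> (blk x) (pos x))"] by (auto simp: p_def)
      thus ?thesis by blast
    qed
    have alg: "two_db_algorithm n (P, Q)" if "set_pmf P \<subseteq> U" for P
      using that U by (auto simp: two_db_algorithm_def Q_def)
    define g where "g = verdict_prob r T Q True"
    have run: "pmf (run_tester r T (P, Q)) True = mean U (\<lambda>x. p Z (\<pi> (blk x) (pos x))) r g"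
      if "set_pmf P \<subseteq> U" "\<forall>x\<in>U. pmf P x = p Z (\<pi> (blk x) (pos x))" for P Z \<pi>
    proof -
      have "mean U (pmf P) r g = mean U (\<lambda>x. p Z (\<pi> (blk x) (pos x))) r g"
        by (rule mean_cong) (use that in auto)
      thus ?thesis using pmf_run_tester[OF U(1), of "(P, Q)"] that by (simp add: g_def)
    qed
    have "2 / 3 - 1 / 3 \<le> real r ^ Suc (Suc k) / real m ^ Suc k"
    proof (rule block_perm_indistinguishable[where U = U and S = "{..<L}" and blk = blk and pos = pos and p = "p X" and q = "p Y" and g = g])
      show "(\<Sum>i\<in>{..<L}. p X i) = 1 / real m"
        using powers[OF LX, of 1] L by (simp add: L_def)
      show "(\<Sum>i\<in>{..<L}. p X i ^ j) = (\<Sum>i\<in>{..<L}. p Y i ^ j)" if "1 \<le> j" "j \<le> Suc k" for j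
        using powers[OF LX that(1)] powers[OF LY that(1)] eq[OF that] by simp
    next
      fix \<pi> assume "\<pi> \<in> {..<m} \<rightarrow>\<^sub>E {\<sigma>. \<sigma> permutes {..<L}}"
      hence \<pi>: "\<pi> \<in> \<Omega>" by (simp add: \<Omega>_def)
      obtain P where P: "set_pmf P \<subseteq> U" "\<forall>x\<in>U. pmf P x = p X (\<pi> (blk x) (pos x))"
        using ex[OF \<pi> LX] by (auto simp: L_def)
      have "is_adp n \<epsilon> \<delta> (P, Q)"
      proof (rule is_adp_of_close[OF alg[OF P(1)]])
        fix E :: "nat set"
        \<comment> \<open>A nonnegative bound for \<open>y - 1\<close> that vanishes at 0 and 1, so
          that its total over a block is the mass of \<open>X\<close> outside the ones, at most
          \<open>\<gamma> * L\<close>.\<close>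
        define h where "h y = (if y = 1 then 0 else real y)" for y :: nat
        have "measure_pmf.prob P E - measure_pmf.prob Q E =
            (\<Sum>x\<in>E \<inter> U. p X (\<pi> (blk x) (pos x)) - 1 / real (m * L))"
          using P U by (simp add: prob Q_def[symmetric] set_pmf_of_set[of U, folded Q_def] sum_subtractf Q)
        also have "\<dots> \<le> (\<Sum>x\<in>E \<inter> U. h (padded X (\<pi> (blk x) (pos x))) / real (m * L))"
          unfolding p_def diff_divide_distrib[symmetric]
          by (intro sum_mono divide_right_mono) (auto simp: h_def)
        also have "\<dots> \<le> (\<Sum>x\<in>U. h (padded X (\<pi> (blk x) (pos x))) / real (m * L))"
          using U by (intro sum_mono2) (auto simp: h_def)
        also have "\<dots> = real m * (\<Sum>i<L. h (padded X i) / real (m * L))"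
          by (rule total[OF \<pi>])
        also have "\<dots> = (\<Sum>i<L. h (padded X i)) / L"
          using m by (simp add: sum_divide_distrib[symmetric])
        also have "(\<Sum>i<L. h (padded X i)) = sum_list (map h X)"
          by (rule sum_padded[OF LX]) (simp add: h_def)
        also have "\<dots> = real L - count_list X 1"
          unfolding L_def by (induction X) (auto simp: h_def power_sum_def)
        also have "\<dots> / L \<le> \<gamma>"
          using X1[folded L_def] L by (simp add: field_simps)
        finally show "measure_pmf.prob (fst (P, Q)) E - measure_pmf.prob (snd (P, Q)) E \<le> \<delta>"
          using \<gamma> by simp
      qed (use \<open>\<epsilon> > 0\<close> in simp)
      thus "2 / 3 \<le> mean U (\<lambda>x. p X (\<pi> (blk x) (pos x))) r g"
        using T alg[OF P(1)] unfolding adp_tester_def run[OF P, symmetric] by blast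
    next
      fix \<pi> assume "\<pi> \<in> {..<m} \<rightarrow>\<^sub>E {\<sigma>. \<sigma> permutes {..<L}}"
      hence \<pi>: "\<pi> \<in> \<Omega>" by (simp add: \<Omega>_def)
      have Y_L: "power_sum Y 1 = L" using eq[of 1] by (simp add: L_def)
      obtain P where P: "set_pmf P \<subseteq> U" "\<forall>x\<in>U. pmf P x = p Y (\<pi> (blk x) (pos x))"
        using ex[OF \<pi> LY Y_L] by auto
      \<comment> \<open>The elements of twice the uniform probability: they carry almost all of
        \<open>P\<close>, and exactly half as much of \<open>Q\<close>, hence at most 1/2.\<close>
      define E where "E = {x \<in> U. padded Y (\<pi> (blk x) (pos x)) = 2}"
      have E: "E \<subseteq> {1..n}" "E \<inter> U = E" using U by (auto simp: E_def)
      define N where "N = count_list Y 2"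
      have light: "real (card E) = real m * real N"
      proof -
        have "real (card E) = (\<Sum>x\<in>U. (\<lambda>y. if y = 2 then 1 else 0) (padded Y (\<pi> (blk x) (pos x))))"
          unfolding E_def using U(1) by (simp add: sum.If_cases Int_def)
        also have "\<dots> = real m * (\<Sum>i<L. (\<lambda>y. if y = 2 then 1 else 0) (padded Y i))"
          by (rule total[OF \<pi>])
        also have "\<dots> = real m * real N"
          by (subst sum_padded[OF LY]) (simp_all add: sum_list_indicator N_def)
        finally show ?thesis .
      qed
      have PE: "measure_pmf.prob P E = 2 * real N / L"
      proof -
        have "measure_pmf.prob P E = (\<Sum>x\<in>E. 2 / real (m * L))"
          unfolding prob[OF P(1)] E(2) using P(2) by (intro sum.cong) (auto simp: E_def p_def)
        thus ?thesis using light m by simp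
      qed
      have QE: "measure_pmf.prob Q E = real N / L"
      proof -
        have "measure_pmf.prob Q E = (\<Sum>x\<in>E. 1 / real (m * L))"
          using U prob[of Q E] by (simp add: Q_def set_pmf_of_set E(2)) (simp add: Q_def[symmetric] Q E_def)
        thus ?thesis using light m by simp
      qed
      have "measure_pmf.prob P E \<ge> 1 - \<gamma>"
        using Y1 L unfolding PE Y_L N_def[symmetric] by (simp add: field_simps)
      moreover have "measure_pmf.prob Q E \<le> 1 / 2"
        using measure_pmf.prob_le_1[of P E] unfolding PE QE by (simp add: mult.commute)
      ultimately have "1 - \<gamma> - exp \<epsilon> * (1 / 2) \<le> measure_pmf.prob P E - exp \<epsilon> * measure_pmf.prob Q E"
        by (intro diff_mono mult_left_mono) auto
      also have "\<dots> \<le> adp_delta n \<epsilon> (P, Q)" using adp_delta_ge(1)[OF E(1), of "(P, Q)"] by simp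
      finally have "far_from_adp n \<epsilon> \<delta> \<alpha> (P, Q)" using \<gamma>(3) by (simp add: far_from_adp_def)
      hence "pmf (run_tester r T (P, Q)) False \<ge> 2 / 3"
        using T alg[OF P(1)] by (auto simp: adp_tester_def)
      thus "mean U (\<lambda>x. p Y (\<pi> (blk x) (pos x))) r g \<le> 1 / 3"
        unfolding pmf_bool_False run[OF P] by simp
    qed (use U m coords block in \<open>auto simp: p_def g_def verdict_prob_bounds\<close>)
    thus ?thesis by (simp add: m_def)
  qed
  thus ?thesis using L by blast
qed

text \<open>The bound of \<open>tester_power_bound\<close> has exponent
  \<open>(k + 1) / (k + 2)\<close>, which exceeds \<open>1 - \<eta>\<close> once
  \<open>k > 1 / \<eta>\<close>; the surplus absorbs all constants for large
  \<open>n\<close>.\<close>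

lemma tester_near_linear:
  fixes \<epsilon> \<delta> \<alpha> \<eta> :: real
  assumes "\<epsilon> > 0" "\<delta> > 0" "\<alpha> > 0" "exp \<epsilon> / 2 + \<delta> + \<alpha> < 1" and \<eta>: "\<eta> > 0"
  shows "eventually (\<lambda>n. \<forall>r T. adp_tester n \<epsilon> \<delta> \<alpha> r T \<longrightarrow> real r \<ge> real n powr (1 - \<eta>)) sequentially"
proof -
  obtain k :: nat where k: "real k > 1 / \<eta>" using reals_Archimedean2 by blast
  \<comment> \<open>The surplus \<open>(k + 1) - (1 - \<eta>) * (k + 2)\<close> of the exponents
    after raising to the power \<open>k + 2\<close>.\<close>
  define e where "e = \<eta> * (real k + 2) - 1"
  have e: "e > 0"
  proof -
    have "1 < \<eta> * real k" using k \<eta> by (simp add: field_simps)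
    thus ?thesis using \<eta> by (simp add: e_def algebra_simps)
  qed
  obtain L where L: "L > 0"
    and bound: "\<And>n r T. n \<ge> L \<Longrightarrow> adp_tester n \<epsilon> \<delta> \<alpha> r T \<Longrightarrow>
      1 / 3 \<le> real r ^ Suc (Suc k) / real (n div L) ^ Suc k"
    using tester_power_bound[OF assms(1-4), of k] by blast
  \<comment> \<open>Collects the advantage 1/3 and the loss in replacing \<open>n div L\<close> by
    \<open>n / (2 * L)\<close>.\<close>
  define C where "C = 3 * (2 * real L) ^ Suc k"
  have C: "C > 0" using L by (simp add: C_def)
  have "((\<lambda>n. real n powr - e) \<longlongrightarrow> 0) sequentially"
    using e by (intro tendsto_neg_powr filterlim_real_sequentially) auto
  hence "eventually (\<lambda>n. real n powr - e < 1 / C) sequentially"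
    by (rule order_tendstoD(2)) (use C in simp)
  moreover have "eventually (\<lambda>n. n \<ge> L) sequentially" by (rule eventually_ge_at_top)
  ultimately show ?thesis
  proof eventually_elim
    case (elim n)
    show ?case
    proof (intro allI impI)
      fix r T assume T: "adp_tester n \<epsilon> \<delta> \<alpha> r T"
      define m where "m = n div L"
      have n: "n > 0" using elim L by simp
      have m: "m > 0" using elim L by (simp add: m_def div_greater_zero_iff)
      have "n < Suc m * L" using L by (simp add: m_def dividend_less_div_times)
      also have "\<dots> \<le> 2 * m * L" using m by (intro mult_right_mono) auto
      finally have "real n \<le> real (2 * m * L)" by (simp only: of_nat_le_iff)
      hence m_ge: "real n / (2 * real L) \<le> real m" using L by (simp add: field_simps)
      have "real n powr ((1 - \<eta>) * real (Suc (Suc k))) = real n powr (real (Suc k) - e)"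
        by (simp add: e_def algebra_simps)
      also have "\<dots> = real n ^ Suc k / real n powr e"
        using n by (simp only: powr_diff powr_realpow of_nat_0_less_iff)
      also have "\<dots> \<le> real n ^ Suc k / C"
        using mult_left_mono[OF less_imp_le[OF elim(1)], of "real n ^ Suc k"]
        by (simp add: powr_minus_divide)
      also have "\<dots> = (real n / (2 * real L)) ^ Suc k / 3"
        by (simp add: C_def power_divide)
      also have "\<dots> \<le> real m ^ Suc k / 3"
        using m_ge by (intro divide_right_mono power_mono) auto
      also have "\<dots> \<le> real r ^ Suc (Suc k)"
        using bound[OF elim(2) T] m by (simp add: m_def[symmetric] field_simps)
      finally have "(real n powr (1 - \<eta>)) ^ Suc (Suc k) \<le> real r ^ Suc (Suc k)"
        using n by (simp add: powr_powr[symmetric] powr_realpow[symmetric] del: power_Suc)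
      thus "real n powr (1 - \<eta>) \<le> real r" by (rule power_le_imp_le_base) simp
    qed
  qed
qed

theorem theorem12:
  fixes \<epsilon> \<delta> :: real
  assumes "\<epsilon> > 0" and "\<delta> > 0"
  shows "\<exists>c>0. \<forall>\<alpha>>0. exp \<epsilon> / 2 + \<delta> + \<alpha> < 1 \<longrightarrow>
    (\<exists>h :: nat \<Rightarrow> real. h \<in> o(\<lambda>_. 1) \<and>
      (\<forall>n\<ge>2. \<forall>r T. adp_tester n \<epsilon> \<delta> \<alpha> r T \<longrightarrow>
         real r \<ge> c * max (real n powr (1 - h n)) (1 / \<alpha>\<^sup>2)))"
proof (cases "exp \<epsilon> / 2 + \<delta> < 1")
  case False
  \<comment> \<open>No positive \<alpha> is admissible here, so any constant serves.\<close>
  thus ?thesis by (intro exI[of _ 1]) auto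
next
  case True
  \<comment> \<open>Depends on \<epsilon> and \<delta> alone, so the constant is uniform in
    \<alpha>.\<close>
  define a where "a = (1/2 - \<delta>) / exp \<epsilon>"
  define c0 where "c0 = a * (1 - a) * ln (4/3) / 4"
  have c0: "c0 > 0"
  proof -
    have x: "exp \<epsilon> > 1" using assms by simp
    hence "\<delta> < 1/2" using True by linarith
    hence "0 < a" by (simp add: a_def)
    moreover have "1/2 - \<delta> < exp \<epsilon>" using x assms by linarith
    hence "a < 1" by (simp add: a_def)
    ultimately show ?thesis by (simp add: c0_def)
  qed
  show ?thesis
  proof (intro exI[of _ "min 1 c0"] conjI allI impI)
    show "min 1 c0 > 0" using c0 by simp
    fix \<alpha> :: real assume \<alpha>: "\<alpha> > 0" "exp \<epsilon> / 2 + \<delta> + \<alpha> < 1"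
    have square: "real r \<ge> c0 * (1 / \<alpha>\<^sup>2)" if "n \<ge> 2" "adp_tester n \<epsilon> \<delta> \<alpha> r T" for n r T
      using tester_ge_inverse_square[OF assms \<alpha> that] by (simp add: c0_def a_def)
    \<comment> \<open>\<open>R n r\<close> says that \<open>r\<close> queries suffice;
      \<open>s n\<close> is the least such number, that is, the query complexity at
      \<open>n\<close>.\<close>
    define R where "R n r \<longleftrightarrow> (\<exists>T. adp_tester n \<epsilon> \<delta> \<alpha> r T)" for n r
    define s where "s n = (LEAST r. R n r)" for n
    have s: "R n (s n)" "s n \<le> r" if "R n r" for n r
      using that by (auto simp: s_def intro: LeastI Least_le)
    have s_pos: "s n > 0" if "R n r" "n \<ge> 2" for n r
    proof -
      have "0 < c0 * (1 / \<alpha>\<^sup>2)" using c0 \<alpha> by simp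
      also have "\<dots> \<le> real (s n)" using square[OF that(2)] s(1)[OF that(1)] by (auto simp: R_def)
      finally show ?thesis by simp
    qed
    \<comment> \<open>The exact deficit of the exponent: \<open>n powr (1 - ln (s n) / ln n)\<close>
      would be \<open>n / s n\<close>, so \<open>1 - h n\<close> is the exponent of
      \<open>s n\<close>, capped at 1. The cap makes \<open>h\<close> nonnegative, which leaves an
      upper bound to prove; without a tester the claim at \<open>n\<close> is vacuous and 0 is a
      default.\<close>
    define h where "h n = (if \<exists>r. R n r then max 0 (1 - ln (s n) / ln n) else 0)" for n
    have "h \<longlonglongrightarrow> 0"
    proof (rule tendstoI)
      fix \<eta> :: real assume "\<eta> > 0"
      \<comment> \<open>Halving \<eta> turns the weak inequality of
        \<open>tester_near_linear\<close> into the strict one required for the limit.\<close>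
      hence "\<eta> / 2 > 0" by simp
      from tester_near_linear[OF assms \<alpha> this] eventually_ge_at_top[of 2]
      show "eventually (\<lambda>n. dist (h n) 0 < \<eta>) sequentially"
      proof eventually_elim
        case (elim n)
        show ?case
        proof (cases "\<exists>r. R n r")
          case True
          then obtain r where r: "R n r" ..
          have "real n powr (1 - \<eta> / 2) \<le> real (s n)"
            using elim(1) s(1)[OF r] by (auto simp: R_def)
          hence "ln (real n powr (1 - \<eta> / 2)) \<le> ln (real (s n))"
            using elim(2) s_pos[OF r elim(2)] by (subst ln_le_cancel_iff) auto
          hence "(1 - \<eta> / 2) * ln (real n) \<le> ln (real (s n))"
            using elim(2) by (simp add: ln_powr)
          hence "1 - \<eta> / 2 \<le> ln (real (s n)) / ln (real n)"
            using elim(2) by (simp add: pos_le_divide_eq)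
          thus ?thesis using \<open>\<eta> > 0\<close> by (auto simp: h_def)
        qed (use \<open>\<eta> > 0\<close> in \<open>simp add: h_def\<close>)
      qed
    qed
    hence h: "h \<in> o(\<lambda>_. 1)" by (intro smalloI_tendsto) auto
    have "real r \<ge> min 1 c0 * max (real n powr (1 - h n)) (1 / \<alpha>\<^sup>2)"
      if n: "n \<ge> 2" and T: "adp_tester n \<epsilon> \<delta> \<alpha> r T" for n r T
    proof -
      have r: "R n r" using T by (auto simp: R_def)
      have "real n powr (1 - h n) \<le> real n powr (ln (s n) / ln n)"
        using n r by (intro powr_mono) (auto simp: h_def)
      also have "\<dots> = real (s n)"
        using n s_pos[OF r n] by (simp add: powr_def)
      also have "\<dots> \<le> real r" using s(2)[OF r] by simp
      finally have 1: "min 1 c0 * (real n powr (1 - h n)) \<le> real r"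
        by (smt (verit, best) c0 mult_left_le_one_le powr_ge_zero)
      have "min 1 c0 * (1 / \<alpha>\<^sup>2) \<le> c0 * (1 / \<alpha>\<^sup>2)" by (intro mult_right_mono) auto
      hence 2: "min 1 c0 * (1 / \<alpha>\<^sup>2) \<le> real r" using square[OF n T] by linarith
      show ?thesis using 1 2 by (simp add: max_def)
    qed
    thus "\<exists>h. h \<in> o(\<lambda>_. 1) \<and> (\<forall>n\<ge>2. \<forall>r T. adp_tester n \<epsilon> \<delta> \<alpha> r T \<longrightarrow>
        real r \<ge> min 1 c0 * max (real n powr (1 - h n)) (1 / \<alpha>\<^sup>2))"
      using h by blast
  qed
qed

end
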